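(* Let $\kappa$ be an uncountable cardinal with $\kappa=\kappa^{<\kappa}$. Then there is a closed non-empty subset of ${}^\kappa\kappa$ that is not the continuous image of ${}^\kappa\kappa$ (i.e. there is no continuous function $f:{}^\kappa\kappa\to{}^\kappa\kappa$ whose range is this set).
   Context: For a cardinal $\mu$, ${}^\kappa\mu$ is the set of all functions $x:\kappa\to\mu$ and ${}^{<\kappa}\mu$ is the set of all functions $t:\alpha\to\mu$ with $\alpha<\kappa$. The space ${}^\kappa\mu$ carries the topology whose basic open sets are $N_s=\{x\in{}^\kappa\mu : s\subseteq x\}$ for $s\in{}^{<\kappa}\mu$. *)

theory Defs
  imports Main "HOL-Library.Countable_Set"
begin

text \<open>The cardinal kappa is represented by a type 'k together with a cardinal
  well-order r on UNIV (card_order r). Ordinals below kappa are the elements of 'k,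
  the ordinal alpha < kappa corresponding to gamma is the initial segment underS r gamma.
  Elements of the generalized Baire space are total functions 'k => 'k.\<close>

definition short_seqs :: "'k rel \<Rightarrow> ('k \<Rightarrow> 'k option) set" where
  "short_seqs r = {s. \<exists>\<gamma>. dom s = underS r \<gamma>}"

definition basic_nbhd :: "('k \<Rightarrow> 'k option) \<Rightarrow> ('k \<Rightarrow> 'k) set" where
  "basic_nbhd s = {x. \<forall>\<beta>\<in>dom s. s \<beta> = Some (x \<beta>)}"

definition baire_open :: "'k rel \<Rightarrow> ('k \<Rightarrow> 'k) set \<Rightarrow> bool" where
  "baire_open r U \<longleftrightarrow> (\<exists>B. B \<subseteq> basic_nbhd ` short_seqs r \<and> U = \<Union>B)"

definition baire_closed :: "'k rel \<Rightarrow> ('k \<Rightarrow> 'k) set \<Rightarrow> bool" where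
  "baire_closed r C \<longleftrightarrow> baire_open r (- C)"

definition baire_continuous :: "'k rel \<Rightarrow> (('k \<Rightarrow> 'k) \<Rightarrow> ('k \<Rightarrow> 'k)) \<Rightarrow> bool" where
  "baire_continuous r f \<longleftrightarrow> (\<forall>U. baire_open r U \<longrightarrow> baire_open r (f -` U))"

end

theory Submission
  imports Defs
begin

text \<open>Functions from kappa to kappa code binary relations on kappa, and C is the set of codes of
  well-founded relations. Since kappa has uncountable cofinality (Koenig's theorem applied to
  kappa to the power omega), an infinite descending chain is visible in a proper initial segment
  of the code, so C is closed. Given a continuous f with values in C, order the pairs (s, a), with s
  a short sequence and a below kappa, by letting (s', a') be below (s, a) if s' extends s and forces a'
  to be below a in the relation coded by f. A descending chain of pairs would produce a single x with
  f x ill-founded, so this order is well-founded, and it has at most kappa many elements. Its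
  extension by a top element is therefore coded by some member of C, but this member cannot be f y:
  iterating the assignment of (s, a) to a pair (s', (s, a)) with s' an initial segment of y would yield
  an infinite descending chain starting at the top element.\<close>

section \<open>Openness as agreement on initial segments\<close>

lemma baire_open_iff:
  "baire_open r U \<longleftrightarrow> (\<forall>x\<in>U. \<exists>\<gamma>. \<forall>y. (\<forall>\<beta>\<in>underS r \<gamma>. y \<beta> = x \<beta>) \<longrightarrow> y \<in> U)"
proof
  assume "baire_open r U"
  then obtain B where B: "B \<subseteq> basic_nbhd ` short_seqs r" "U = \<Union>B"
    unfolding baire_open_def by blast
  show "\<forall>x\<in>U. \<exists>\<gamma>. \<forall>y. (\<forall>\<beta>\<in>underS r \<gamma>. y \<beta> = x \<beta>) \<longrightarrow> y \<in> U"
  proof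
    fix x assume "x \<in> U"
    then obtain s \<gamma> where s: "basic_nbhd s \<in> B" "x \<in> basic_nbhd s" "dom s = underS r \<gamma>"
      using B by (force simp: short_seqs_def)
    have "y \<in> U" if "\<forall>\<beta>\<in>underS r \<gamma>. y \<beta> = x \<beta>" for y
    proof -
      have "y \<in> basic_nbhd s" using that s(2,3) by (simp add: basic_nbhd_def)
      then show ?thesis using s(1) B(2) by blast
    qed
    then show "\<exists>\<gamma>. \<forall>y. (\<forall>\<beta>\<in>underS r \<gamma>. y \<beta> = x \<beta>) \<longrightarrow> y \<in> U" by blast
  qed
next
  assume nbhd: "\<forall>x\<in>U. \<exists>\<gamma>. \<forall>y. (\<forall>\<beta>\<in>underS r \<gamma>. y \<beta> = x \<beta>) \<longrightarrow> y \<in> U"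
  let ?B = "basic_nbhd ` {s \<in> short_seqs r. basic_nbhd s \<subseteq> U}"
  have "x \<in> \<Union>?B" if "x \<in> U" for x
  proof -
    obtain \<gamma> where \<gamma>: "\<And>y. (\<forall>\<beta>\<in>underS r \<gamma>. y \<beta> = x \<beta>) \<Longrightarrow> y \<in> U"
      using nbhd \<open>x \<in> U\<close> by blast
    let ?s = "(Some \<circ> x) |` underS r \<gamma>"
    have dom: "dom ?s = underS r \<gamma>" by (auto simp: restrict_map_def split: if_splits)
    then have "?s \<in> short_seqs r" by (auto simp: short_seqs_def)
    moreover have "basic_nbhd ?s \<subseteq> U" "x \<in> basic_nbhd ?s"
      using \<gamma> dom by (auto simp: basic_nbhd_def)
    ultimately show ?thesis by blast
  qed
  then have "U = \<Union>?B" by blast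
  then show "baire_open r U" unfolding baire_open_def by (intro exI[of _ ?B]) blast
qed

section \<open>Cardinal arithmetic: uncountable cofinality of kappa\<close>

lemma underS_linear_cases:
  assumes "Linear_order r" "a \<in> Field r" "b \<in> Field r"
  shows "a \<in> underS r b \<or> a = b \<or> b \<in> underS r a"
  using assms unfolding order_on_defs total_on_def underS_def by blast

lemma underS_mono:
  assumes "Linear_order r" "a \<in> underS r b"
  shows "underS r a \<subseteq> underS r b"
  using assms unfolding order_on_defs underS_def trans_def antisym_def by blast

lemma card_order_Linear_order:
  assumes "card_order r"
  shows "Linear_order r" "Field r = UNIV"
  using assms card_order_on_Card_order[OF assms]
  by (auto simp: card_order_on_def well_order_on_def)

text \<open>If all initial segments were finite, their sizes would inject kappa into the natural
  numbers.\<close>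

lemma infinite_underS_if_uncountable:
  assumes "card_order (r :: 'k rel)" "\<not> countable (UNIV :: 'k set)"
  shows "\<exists>\<gamma>. infinite (underS r \<gamma>)"
proof (rule ccontr)
  assume fin: "\<nexists>\<gamma>. infinite (underS r \<gamma>)"
  note lin = card_order_Linear_order[OF assms(1)]
  have less: "card (underS r a) < card (underS r b)" if "a \<in> underS r b" for a b
  proof (rule psubset_card_mono)
    show "finite (underS r b)" using fin by blast
    show "underS r a \<subset> underS r b"
      using underS_mono[OF lin(1) that] that by (auto simp: underS_def)
  qed
  have "inj (\<lambda>a. card (underS r a))"
  proof (rule injI)
    fix a b assume "card (underS r a) = card (underS r b)"
    then show "a = b"
      using underS_linear_cases[OF lin(1), of a b] lin(2) less[of a b] less[of b a] by auto
  qed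
  then show False using assms(2) by (auto intro: countableI)
qed

text \<open>The cardinal hypothesis enters the argument through this injection: it bounds kappa to
  the power omega, and later it turns short sequences into points of kappa.\<close>

lemma inj_into_short_seqs_type:
  assumes "card_order (r :: 'k rel)" "ordIso2 (card_of (short_seqs r)) r"
  shows "\<exists>g :: ('k \<Rightarrow> 'k option) \<Rightarrow> 'k. inj_on g (short_seqs r)"
proof -
  have "Field r = UNIV" using assms card_order_Linear_order(2) by blast
  moreover have "ordIso2 (card_of (Field r)) r"
    using assms(1) card_of_Field_ordIso card_order_on_Card_order by blast
  ultimately have "ordIso2 (card_of (short_seqs r)) (card_of (UNIV :: 'k set))"
    using assms(2) ordIso_symmetric ordIso_transitive by metis
  then obtain g where "bij_betw g (short_seqs r) (UNIV :: 'k set)"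
    using card_of_ordIso by blast
  then show ?thesis by (auto simp: bij_betw_def)
qed

lemma inj_sequences_if_short_seqs:
  assumes "card_order (r :: 'k rel)" "\<not> countable (UNIV :: 'k set)"
    and "ordIso2 (card_of (short_seqs r)) r"
  shows "\<exists>h :: (nat \<Rightarrow> 'k) \<Rightarrow> 'k. inj h"
proof -
  obtain \<gamma> where "infinite (underS r \<gamma>)" using infinite_underS_if_uncountable assms by blast
  then obtain d :: "nat \<Rightarrow> 'k" where d: "inj d" "range d \<subseteq> underS r \<gamma>"
    using infinite_countable_subset by blast
  obtain g :: "('k \<Rightarrow> 'k option) \<Rightarrow> 'k" where g: "inj_on g (short_seqs r)"
    using inj_into_short_seqs_type assms by blast
  \<comment> \<open>An omega-sequence is spread along \<open>d\<close> over one infinite initial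
    segment. Off the range of \<open>d\<close> the values of \<open>inv d\<close> are arbitrary;
    they only make the domain a full initial segment, while injectivity of \<open>E\<close> is read
    off at the points \<open>d n\<close>.\<close>
  define E where "E u = (Some \<circ> u \<circ> inv d) |` underS r \<gamma>" for u :: "nat \<Rightarrow> 'k"
  have "inj E"
  proof (rule injI, rule ext)
    fix u v n assume "E u = E v"
    then have "E u (d n) = E v (d n)" by simp
    moreover have "d n \<in> underS r \<gamma>" using d(2) by blast
    ultimately show "u n = v n" using d(1) by (simp add: E_def)
  qed
  moreover have "dom (E u) = underS r \<gamma>" for u
    by (auto simp: E_def restrict_map_def split: if_splits)
  then have "range E \<subseteq> short_seqs r" by (auto simp: short_seqs_def)
  then have "inj_on g (range E)" using g inj_on_subset by blast
  ultimately show ?thesis using comp_inj_on by blast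
qed

text \<open>The diagonal argument of Koenig's theorem.\<close>

lemma countable_bounded_if_short_seqs:
  fixes c :: "nat \<Rightarrow> 'k"
  assumes "card_order (r :: 'k rel)" "\<not> countable (UNIV :: 'k set)"
    and "ordIso2 (card_of (short_seqs r)) r"
  shows "\<exists>\<gamma>. range c \<subseteq> underS r \<gamma>"
proof (rule ccontr)
  assume unb: "\<nexists>\<gamma>. range c \<subseteq> underS r \<gamma>"
  note lin = card_order_Linear_order[OF assms(1)]
  obtain h :: "(nat \<Rightarrow> 'k) \<Rightarrow> 'k" where h: "inj h"
    using inj_sequences_if_short_seqs assms by blast
  have Card: "Card_order r" using assms(1) card_order_on_Card_order by blast
  \<comment> \<open>Fewer than kappa many ordinals lie below \<open>c n\<close>, so the sequences
    they decode to cannot take all values at coordinate n. The missed values are the entries of the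
    diagonal sequence.\<close>
  have small: "\<exists>v. \<forall>\<alpha>\<in>underS r (c n). v \<noteq> inv h \<alpha> n" for n
  proof (rule ccontr)
    assume "\<nexists>v. \<forall>\<alpha>\<in>underS r (c n). v \<noteq> inv h \<alpha> n"
    then have "UNIV = (\<lambda>\<alpha>. inv h \<alpha> n) ` underS r (c n)" by blast
    then have "ordLeq3 (card_of (UNIV :: 'k set)) (card_of (underS r (c n)))"
      using card_of_image by metis
    moreover have "ordLess2 (card_of (underS r (c n))) r"
      using card_of_underS[OF Card] lin(2) by blast
    moreover have "ordIso2 r (card_of (UNIV :: 'k set))"
      using card_of_Field_ordIso[OF Card] lin(2) ordIso_symmetric by metis
    ultimately show False
      using not_ordLess_ordLeq ordLess_ordIso_trans by blast
  qed
  then obtain v where v: "\<And>n \<alpha>. \<alpha> \<in> underS r (c n) \<Longrightarrow> v n \<noteq> inv h \<alpha> n" by metis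
  have "infinite (Field r)" using assms(2) lin(2) countable_finite by metis
  \<comment> \<open>An infinite cardinal is a limit, so some \<gamma> lies strictly above
    \<open>h v\<close>. A \<open>c n\<close> that is not below \<gamma> then lies above
    \<open>h v\<close>. But \<open>h v\<close> decodes to \<open>v\<close>, which would have to
    differ from itself at n.\<close>
  then obtain \<gamma> where \<gamma>: "h v \<in> underS r \<gamma>"
    using infinite_Card_order_limit[OF Card, of "h v"] lin(2) by (auto simp: underS_def)
  obtain n where "c n \<notin> underS r \<gamma>" using unb by blast
  then have "h v \<in> underS r (c n)"
    using underS_linear_cases[OF lin(1), of "c n" \<gamma>] lin(2) underS_mono[OF lin(1), of \<gamma> "c n"] \<gamma>
    by auto
  from v[OF this] show False using h by simp
qed

section \<open>The closed set of codes of well-founded relations\<close>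

definition coded_rel :: "('k \<times> 'k \<Rightarrow> 'k) \<Rightarrow> 'k \<Rightarrow> ('k \<Rightarrow> 'k) \<Rightarrow> 'k rel" where
  "coded_rel p z x = {q. x (p q) = z}"

lemma baire_closed_wf_codes:
  assumes bounded: "\<And>c :: nat \<Rightarrow> 'k. \<exists>\<gamma>. range c \<subseteq> underS r \<gamma>"
  shows "baire_closed r {x. wf (coded_rel p z x)}"
  unfolding baire_closed_def baire_open_iff
proof
  fix x assume "x \<in> - {x. wf (coded_rel p z x)}"
  then obtain a where a: "\<And>i. (a (Suc i), a i) \<in> coded_rel p z x"
    by (auto simp: wf_iff_no_infinite_down_chain)
  \<comment> \<open>The chain depends on countably many coordinates of \<open>x\<close>, one for
    each consecutive pair, and these have a common bound.\<close>
  obtain \<gamma> where \<gamma>: "range (\<lambda>i. p (a (Suc i), a i)) \<subseteq> underS r \<gamma>"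
    using bounded by blast
  have "\<not> wf (coded_rel p z y)" if "\<forall>\<beta>\<in>underS r \<gamma>. y \<beta> = x \<beta>" for y
  proof -
    have "(a (Suc i), a i) \<in> coded_rel p z y" for i
      using a[of i] that \<gamma> by (auto simp: coded_rel_def)
    then show ?thesis by (auto simp: wf_iff_no_infinite_down_chain)
  qed
  then show "\<exists>\<gamma>. \<forall>y. (\<forall>\<beta>\<in>underS r \<gamma>. y \<beta> = x \<beta>) \<longrightarrow> y \<in> - {x. wf (coded_rel p z x)}"
    by auto
qed

section \<open>The order of forced descents\<close>

definition forcing_rel ::
  "(('k \<Rightarrow> 'k) \<Rightarrow> 'k rel) \<Rightarrow> (('k \<Rightarrow> 'k option) \<times> 'k) rel" where
  "forcing_rel R = {((s', a'), (s, a)). s \<subseteq>\<^sub>m s' \<and> (\<forall>x\<in>basic_nbhd s'. (a', a) \<in> R x)}"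

lemma wf_forcing_rel:
  assumes "\<And>x. wf (R x)"
  shows "wf (forcing_rel R)"
  unfolding wf_iff_no_infinite_down_chain
proof
  assume "\<exists>t. \<forall>i. (t (Suc i), t i) \<in> forcing_rel R"
  then obtain t where t: "\<And>i. (t (Suc i), t i) \<in> forcing_rel R" by blast
  define s where "s i = fst (t i)" for i
  define a where "a i = snd (t i)" for i
  have step: "s i \<subseteq>\<^sub>m s (Suc i)" "\<And>x. x \<in> basic_nbhd (s (Suc i)) \<Longrightarrow> (a (Suc i), a i) \<in> R x" for i
    using t[of i] by (auto simp: forcing_rel_def s_def a_def split: prod.splits)
  have mono: "s i \<subseteq>\<^sub>m s j" if "i \<le> j" for i j
    using that by (induction rule: dec_induct) (auto intro: map_le_trans step)
  \<comment> \<open>This is the union of the increasing chain \<open>s i\<close>. Where no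
    \<open>s i\<close> is defined the value is arbitrary, which is harmless since
    \<open>basic_nbhd (s i)\<close> constrains only the domain of \<open>s i\<close>.\<close>
  define x where "x \<beta> = (THE v. \<exists>i. s i \<beta> = Some v)" for \<beta>
  have x: "x \<beta> = v" if "s i \<beta> = Some v" for i \<beta> v
    unfolding x_def
  proof (rule the_equality)
    fix w assume "\<exists>j. s j \<beta> = Some w"
    then obtain j where "s j \<beta> = Some w" ..
    then show "w = v"
      using that mono[of i j] mono[of j i] nat_le_linear[of i j]
      by (force simp: map_le_def)
  qed (use that in blast)
  have "x \<in> basic_nbhd (s i)" for i
    using x by (force simp: basic_nbhd_def)
  then have "\<And>i. (a (Suc i), a i) \<in> R x" using step(2) by blast
  then show False using assms by (auto simp: wf_iff_no_infinite_down_chain)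
qed

text \<open>Whether \<open>q\<close> belongs to the coded relation depends on the single coordinate
  \<open>p q\<close>, so it is an open condition and continuity pulls it back to a neighbourhood of
  \<open>y\<close>. Choosing \<gamma>' beyond the given \<gamma> makes the forcing segment extend
  the earlier one.\<close>

lemma forced_by_initial_segment:
  assumes "card_order (r :: 'k rel)"
    and bounded: "\<And>c :: nat \<Rightarrow> 'k. \<exists>\<gamma>. range c \<subseteq> underS r \<gamma>"
    and cont: "baire_continuous r f"
    and q: "q \<in> coded_rel p z (f y)"
  shows "\<exists>\<gamma>'. underS r \<gamma> \<subseteq> underS r \<gamma>' \<and>
           (\<forall>x \<in> basic_nbhd ((Some \<circ> y) |` underS r \<gamma>'). q \<in> coded_rel p z (f x))"
proof -
  note lin = card_order_Linear_order[OF assms(1)]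
  obtain \<delta> where \<delta>: "p q \<in> underS r \<delta>" using bounded[of "\<lambda>_. p q"] by blast
  have "baire_open r {u. q \<in> coded_rel p z u}"
    unfolding baire_open_iff coded_rel_def using \<delta> by auto
  then have "baire_open r (f -` {u. q \<in> coded_rel p z u})"
    using cont unfolding baire_continuous_def by blast
  then obtain \<epsilon> where \<epsilon>: "\<And>x. (\<forall>\<beta>\<in>underS r \<epsilon>. x \<beta> = y \<beta>) \<Longrightarrow> q \<in> coded_rel p z (f x)"
    unfolding baire_open_iff using q by fastforce
  have "underS r \<gamma> \<subseteq> underS r \<epsilon> \<or> underS r \<epsilon> \<subseteq> underS r \<gamma>"
    using underS_linear_cases[OF lin(1), of \<gamma> \<epsilon>] lin underS_mono[OF lin(1)] by blast
  then obtain \<gamma>' where \<gamma>': "underS r \<gamma> \<subseteq> underS r \<gamma>'" "underS r \<epsilon> \<subseteq> underS r \<gamma>'" by blast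
  have "q \<in> coded_rel p z (f x)" if "x \<in> basic_nbhd ((Some \<circ> y) |` underS r \<gamma>')" for x
  proof (rule \<epsilon>, rule)
    fix \<beta> assume "\<beta> \<in> underS r \<epsilon>"
    then have "\<beta> \<in> underS r \<gamma>'" using \<gamma>' by blast
    then show "x \<beta> = y \<beta>" using that by (force simp: basic_nbhd_def)
  qed
  with \<gamma>' show ?thesis by blast
qed

section \<open>Diagonalisation against a continuous map\<close>

lemma wf_image_with_top:
  assumes "wf Q" "inj_on e A" "m \<notin> e ` A"
  shows "wf ({(e t', e t) | t' t. t' \<in> A \<and> t \<in> A \<and> (t', t) \<in> Q} \<union> e ` A \<times> {m})"
proof (rule wf_Un)
  have "{(e t', e t) | t' t. t' \<in> A \<and> t \<in> A \<and> (t', t) \<in> Q} \<subseteq>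
      {(a, b). a \<in> e ` A \<and> b \<in> e ` A \<and> (inv_into A e a, inv_into A e b) \<in> Q}"
    using assms(2) by auto
  moreover have "wf {(a, b). a \<in> e ` A \<and> b \<in> e ` A \<and> (inv_into A e a, inv_into A e b) \<in> Q}"
    by (rule wf_subset[OF wf_inv_image[OF assms(1), of "inv_into A e"]]) (auto simp: inv_image_def)
  ultimately show "wf {(e t', e t) | t' t. t' \<in> A \<and> t \<in> A \<and> (t', t) \<in> Q}"
    by (rule wf_subset[rotated])
  show "wf (e ` A \<times> {m})"
    unfolding wf_iff_no_infinite_down_chain
  proof
    assume "\<exists>d. \<forall>i. (d (Suc i), d i) \<in> e ` A \<times> {m}"
    then obtain d where "\<And>i. (d (Suc i), d i) \<in> e ` A \<times> {m}" by blast
    from this[of 0] this[of 1] show False using assms(3) by auto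
  qed
  \<comment> \<open>Nothing has \<open>m\<close> below it, so a descending chain can meet
    \<open>m\<close> only as its first entry.\<close>
  show "Domain {(e t', e t) | t' t. t' \<in> A \<and> t \<in> A \<and> (t', t) \<in> Q} \<inter> Range (e ` A \<times> {m}) = {}"
    using assms(3) by auto
qed

lemma exists_coded_rel:
  assumes "inj p" "w \<noteq> z"
  shows "\<exists>x. coded_rel p z x = R"
proof
  \<comment> \<open>Any value other than \<open>z\<close> signals non-membership; \<open>w\<close>
    supplies one.\<close>
  show "coded_rel p z (\<lambda>\<beta>. if \<beta> \<in> p ` R then z else w) = R"
    using assms by (auto simp: coded_rel_def inj_image_mem_iff)
qed

lemma range_neq_wf_codes:
  fixes r :: "'k rel" and p :: "'k \<times> 'k \<Rightarrow> 'k"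
  assumes r: "card_order r"
    and bounded: "\<And>c :: nat \<Rightarrow> 'k. \<exists>\<gamma>. range c \<subseteq> underS r \<gamma>"
    and g: "inj_on (g :: _ \<Rightarrow> 'k) (short_seqs r)"
    and p: "inj p" and "w \<noteq> z"
    and cont: "baire_continuous r f"
  shows "range f \<noteq> {x. wf (coded_rel p z x)}"
proof
  assume range: "range f = {x. wf (coded_rel p z x)}"
  define Q where "Q = forcing_rel (\<lambda>x. coded_rel p z (f x))"
  have Q: "wf Q" unfolding Q_def using range by (intro wf_forcing_rel) blast
  \<comment> \<open>\<open>Q\<close> compares arbitrary partial functions. Restricting to short
    sequences leaves few enough pairs for \<open>g\<close> and \<open>p\<close> to code them as
    points of kappa.\<close>
  define A where "A = short_seqs r \<times> (UNIV :: 'k set)"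
  \<comment> \<open>The first coordinate is a tag: \<open>z\<close> marks codes of pairs and
    \<open>w\<close> marks the top element, so \<open>m\<close> is not the code of a pair.\<close>
  define e where "e t = p (z, p (g (fst t), snd t))" for t :: "('k \<Rightarrow> 'k option) \<times> 'k"
  define m where "m = p (w, z)"
  have e: "inj_on e A"
    by (rule inj_onI) (auto simp: e_def A_def inj_eq[OF p] dest: inj_onD[OF g])
  have m: "m \<notin> e ` A" using \<open>w \<noteq> z\<close> by (auto simp: e_def m_def inj_eq[OF p])
  define R where
    "R = {(e t', e t) | t' t. t' \<in> A \<and> t \<in> A \<and> (t', t) \<in> Q} \<union> e ` A \<times> {m}"
  obtain x where x: "coded_rel p z x = R" using exists_coded_rel[OF p \<open>w \<noteq> z\<close>] by blast
  then have "x \<in> range f"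
    unfolding range R_def using wf_image_with_top[OF Q e m] by simp
  then obtain y where y: "coded_rel p z (f y) = R" using x by blast
  have A: "((Some \<circ> y) |` underS r \<gamma>, a) \<in> A" for \<gamma> a
  proof -
    have "dom ((Some \<circ> y) |` underS r \<gamma>) = underS r \<gamma>"
      by (auto simp: restrict_map_def split: if_splits)
    then show ?thesis by (auto simp: A_def short_seqs_def)
  qed
  \<comment> \<open>Induction along \<open>Q\<close>. Since \<open>R\<close> is the relation coded
    by \<open>f y\<close>, a longer segment of \<open>y\<close> forces \<open>e t\<close> below
    \<open>a\<close>. Paired with \<open>e t\<close> itself, this segment gives a node
    \<open>t'\<close> that is \<open>Q\<close>-below \<open>t\<close>. Then \<open>e t'\<close> is
    below \<open>e t\<close> in \<open>R\<close>, so the induction hypothesis applies with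
    \<open>e t\<close> in the role of \<open>a\<close>.\<close>
  have no_descent: False if "t = ((Some \<circ> y) |` underS r \<gamma>, a)" "(e t, a) \<in> R" for t \<gamma> a
    using Q that
  proof (induction t arbitrary: \<gamma> a rule: wf_induct_rule)
    case (less t)
    then have "(e t, a) \<in> coded_rel p z (f y)" using y by simp
    then obtain \<gamma>' where \<gamma>': "underS r \<gamma> \<subseteq> underS r \<gamma>'"
      "\<And>x. x \<in> basic_nbhd ((Some \<circ> y) |` underS r \<gamma>') \<Longrightarrow> (e t, a) \<in> coded_rel p z (f x)"
      using forced_by_initial_segment[OF r bounded cont] by metis
    define t' where "t' = ((Some \<circ> y) |` underS r \<gamma>', e t)"
    have "(Some \<circ> y) |` underS r \<gamma> \<subseteq>\<^sub>m (Some \<circ> y) |` underS r \<gamma>'"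
      using \<gamma>'(1) by (auto simp: map_le_def restrict_map_def split: if_splits)
    then have "(t', t) \<in> Q"
      using \<gamma>'(2) unfolding Q_def forcing_rel_def t'_def less.prems(1) by blast
    moreover have "t' \<in> A" "t \<in> A"
      unfolding t'_def less.prems(1) by (rule A)+
    ultimately have "(e t', e t) \<in> R" unfolding R_def by blast
    then show False by (rule less.IH[OF \<open>(t', t) \<in> Q\<close> t'_def])
  qed
  \<comment> \<open>The descent starts at the top \<open>m\<close>, below which every code lies; the
    first segment of \<open>y\<close> may be any, hence \<open>undefined\<close>.\<close>
  show False
    by (rule no_descent[of _ undefined m, OF refl]) (use A in \<open>auto simp: R_def\<close>)
qed

theorem theorem1p5:
  fixes r :: "'k rel"
  assumes "card_order r"
    and "\<not> countable (UNIV :: 'k set)"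
    and "ordIso2 (card_of (short_seqs r)) r"
  shows "\<exists>C :: ('k \<Rightarrow> 'k) set. baire_closed r C \<and> C \<noteq> {} \<and>
           \<not> (\<exists>f. baire_continuous r f \<and> range f = C)"
proof -
  have inf: "infinite (UNIV :: 'k set)" using assms(2) countable_finite by blast
  then have "ordIso2 (card_of ((UNIV :: 'k set) \<times> (UNIV :: 'k set))) (card_of (UNIV :: 'k set))"
    by (rule card_of_Times_same_infinite)
  then obtain p :: "'k \<times> 'k \<Rightarrow> 'k" where p: "inj p"
    using card_of_ordIso[of "(UNIV :: 'k set) \<times> (UNIV :: 'k set)" "UNIV :: 'k set"]
    by (auto simp: bij_betw_def)
  obtain w z :: 'k where wz: "w \<noteq> z"
    using ex_new_if_finite[OF inf, of "{undefined}"] by auto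
  have bounded: "\<exists>\<gamma>. range c \<subseteq> underS r \<gamma>" for c :: "nat \<Rightarrow> 'k"
    using countable_bounded_if_short_seqs assms by blast
  obtain g :: "('k \<Rightarrow> 'k option) \<Rightarrow> 'k" where g: "inj_on g (short_seqs r)"
    using inj_into_short_seqs_type assms by blast
  let ?C = "{x. wf (coded_rel p z x)}"
  \<comment> \<open>The empty relation is well-founded, and its code is a point of the closed
    set.\<close>
  obtain x where "coded_rel p z x = {}" using exists_coded_rel[OF p wz] by blast
  then have "wf (coded_rel p z x)" by simp
  then have "?C \<noteq> {}" by blast
  moreover have "baire_closed r ?C" using bounded by (rule baire_closed_wf_codes)
  moreover have "\<not> (\<exists>f. baire_continuous r f \<and> range f = ?C)"
    using range_neq_wf_codes[OF assms(1) bounded g p wz] by blast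
  ultimately show ?thesis by blast
qed

end
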